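(* Let $M=(E,r)$ be a matroid with $E$ nonempty, and write $r(M)=r(E)$. Then \[ Q'_M(x,y)=\frac{x^{|E|-r(M)}\,y^{r(M)}}{x+y-1}\cdot T_M\!\left(\frac{x+y-1}{y},\ \frac{x+y-1}{x}\right), \] as an identity of rational functions.
   Context: For a polymatroid (in particular a matroid) $M=(E,r)$ with ground set $E$, a base is a vector $\mathbf x\in\mathbb Z^E$ with $\sum_{i\in E}x_i=r(E)$ and $\sum_{i\in S}x_i\le r(S)$ for all $S\subseteq E$; $P(M)$ is the convex hull of the bases. For a matroid, the bases are exactly the indicator vectors $\mathbf e_B$ of the matroid bases $B$. Let $\Delta=\operatorname{conv}\{\mathbf e_i:i\in E\}\subseteq\mathbb R^E$ and $\nabla=-\Delta$. For integers $t,u\ge 0$ let $Q_M(t,u)=\#\big((P(M)+u\Delta+t\nabla)\cap\mathbb Z^E\big)$ (Minkowski sum). This is a polynomial in $t,u$ (of degree $|E|-1$); write it uniquely as $Q_M(t,u)=\sum_{i,j}c_{ij}\binom{u}{j}\binom{t}{i}$ and define $Q'_M(x,y)=\sum_{i,j}c_{ij}(x-1)^i(y-1)^j$. The Tutte polynomial is $T_M(x,y)=\sum_{S\subseteq E}(x-1)^{r(E)-r(S)}(y-1)^{|S|-r(S)}$. *)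

theory Defs
  imports "HOL-Analysis.Analysis"
begin

text \<open>A matroid on the finite ground set E = UNIV of the finite type 'n,
  given by its rank function (standard rank axioms).\<close>
definition matroid_rank :: "('n::finite set \<Rightarrow> nat) \<Rightarrow> bool" where
  "matroid_rank r \<longleftrightarrow>
     (\<forall>S. r S \<le> card S) \<and>
     (\<forall>S T. S \<subseteq> T \<longrightarrow> r S \<le> r T) \<and>
     (\<forall>S T. r (S \<union> T) + r (S \<inter> T) \<le> r S + r T)"

text \<open>Integer points of R^E.\<close>
definition int_points :: "(real ^ 'n) set" where
  "int_points = {x. \<forall>i. x $ i \<in> \<int>}"

text \<open>Bases of the (poly)matroid: integer vectors x with sum over E equal to r(E)
  and sum over S at most r(S) for all S.\<close>
definition bases_vec :: "('n::finite set \<Rightarrow> nat) \<Rightarrow> (real ^ 'n) set" where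
  "bases_vec r = {x \<in> int_points. (\<Sum>i\<in>UNIV. x $ i) = real (r UNIV) \<and>
                    (\<forall>S. (\<Sum>i\<in>S. x $ i) \<le> real (r S))}"

definition base_polytope :: "('n::finite set \<Rightarrow> nat) \<Rightarrow> (real ^ 'n) set" where
  "base_polytope r = convex hull (bases_vec r)"

definition simplex_Delta :: "(real ^ 'n::finite) set" where
  "simplex_Delta = convex hull (range (\<lambda>i. axis i 1))"

definition simplex_Nabla :: "(real ^ 'n::finite) set" where
  "simplex_Nabla = uminus ` simplex_Delta"

text \<open>Q_M(t,u) = number of lattice points of P(M) + u Delta + t Nabla.\<close>
definition QM :: "('n::finite set \<Rightarrow> nat) \<Rightarrow> nat \<Rightarrow> nat \<Rightarrow> nat" where
  "QM r t u = card (int_points \<inter>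
     {p + q + s | p q s. p \<in> base_polytope r \<and> q \<in> (*\<^sub>R) (real u) ` simplex_Delta
                        \<and> s \<in> (*\<^sub>R) (real t) ` simplex_Nabla})"

text \<open>Coefficient c_ij of binom(u,j) binom(t,i) in Q_M(t,u), obtained by
  Newton's forward-difference formula (which recovers the unique coefficients
  of the polynomial Q_M in the binomial basis).\<close>
definition QM_coeff :: "('n::finite set \<Rightarrow> nat) \<Rightarrow> nat \<Rightarrow> nat \<Rightarrow> real" where
  "QM_coeff r i j = (\<Sum>a\<le>i. \<Sum>b\<le>j.
      (-1) ^ (i - a + (j - b)) * real (i choose a) * real (j choose b) * real (QM r a b))"

text \<open>Q'_M(x,y) = sum_{i,j} c_ij (x-1)^i (y-1)^j.  Since Q_M has degree |E|-1,
  c_ij = 0 unless i,j < |E|, so the sum over i,j < |E| is the full sum.\<close>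
definition QM' :: "('n::finite set \<Rightarrow> nat) \<Rightarrow> real \<Rightarrow> real \<Rightarrow> real" where
  "QM' r x y = (\<Sum>i<CARD('n). \<Sum>j<CARD('n). QM_coeff r i j * (x - 1) ^ i * (y - 1) ^ j)"

definition tutte :: "('n::finite set \<Rightarrow> nat) \<Rightarrow> real \<Rightarrow> real \<Rightarrow> real" where
  "tutte r x y = (\<Sum>S\<in>UNIV. (x - 1) ^ (r UNIV - r S) * (y - 1) ^ (card S - r S))"

end

theory Submission
  imports Defs "HOL-Computational_Algebra.Polynomial" "HOL-Library.Multiset"
begin

(* The lattice points of P(M) + u Delta + t Nabla are the integer vectors z with
   sum r(E) + u - t whose sum over their positive support P is at most r(P) + u; a basis
   meeting P in r(P) elements provides the decomposition. Grouping them by P and counting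
   multisets, the hook sum Q(t,u) + sum_{s<t} Q(s,u) + sum_{v<u} Q(t,v) becomes
   sum_P binom(t + |E-P| - r(E) + r(P), |E-P|) * binom(u + r(P), |P|).
   In the binomial basis the hook sum multiplies the generating function C(X,Y) of the
   coefficients c_ij by 1 + X + Y, and the right hand side turns into
   sum_P X^(r(E)-r(P)) (1+X)^(|E-P|-r(E)+r(P)) Y^(|P|-r(P)) (1+Y)^r(P), which is
   x^(|E|-r(M)) y^r(M) T_M((x+y-1)/y, (x+y-1)/x) at X = x - 1, Y = y - 1. On the line
   X + Y = -1 this is an alternating sum over all P and vanishes, so it is divisible by
   1 + X + Y, and the power series C is the quotient, a polynomial of degree below |E|. *)

section \<open>Forward differences and hook sums\<close>

definition fwd_diff :: "(nat \<Rightarrow> real) \<Rightarrow> nat \<Rightarrow> real" where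
  "fwd_diff f i = (\<Sum>a\<le>i. (-1) ^ (i - a) * real (i choose a) * f a)"

lemma fwd_diff_0 [simp]: "fwd_diff f 0 = f 0"
  by (simp add: fwd_diff_def)

lemma fwd_diff_zero [simp]: "fwd_diff (\<lambda>a. 0) i = 0"
  by (simp add: fwd_diff_def)

lemma fwd_diff_diff: "fwd_diff (\<lambda>a. f a - g a) i = fwd_diff f i - fwd_diff g i"
  by (simp add: fwd_diff_def sum_subtractf algebra_simps)

lemma fwd_diff_sum: "finite A \<Longrightarrow> fwd_diff (\<lambda>a. \<Sum>p\<in>A. f p a) i = (\<Sum>p\<in>A. fwd_diff (f p) i)"
  unfolding fwd_diff_def by (simp add: sum_distrib_left sum.swap[of _ A])

lemma fwd_diff_Suc: "fwd_diff f (Suc i) = fwd_diff (\<lambda>a. f (Suc a) - f a) i"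
proof -
  have pascal: "real (Suc i choose a) = real (i choose a) + (if a = 0 then 0 else real (i choose (a - 1)))"
    for a by (cases a) simp_all
  have "fwd_diff f (Suc i) = (\<Sum>a\<le>Suc i. (-1) ^ (Suc i - a) * real (i choose a) * f a)
      + (\<Sum>a\<le>Suc i. (-1) ^ (Suc i - a) * (if a = 0 then 0 else real (i choose (a - 1))) * f a)"
    unfolding fwd_diff_def pascal by (simp only: sum.distrib distrib_left distrib_right)
  also have "(\<Sum>a\<le>Suc i. (-1) ^ (Suc i - a) * real (i choose a) * f a) = - fwd_diff f i"
  proof -
    have "(\<Sum>a\<le>Suc i. (-1) ^ (Suc i - a) * real (i choose a) * f a)
        = (\<Sum>a\<le>i. - ((-1) ^ (i - a) * real (i choose a) * f a))"
      by (simp add: Suc_diff_le)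
    then show ?thesis by (simp add: fwd_diff_def sum_negf)
  qed
  also have "(\<Sum>a\<le>Suc i. (-1) ^ (Suc i - a) * (if a = 0 then 0 else real (i choose (a - 1))) * f a)
      = fwd_diff (\<lambda>a. f (Suc a)) i"
    by (simp add: fwd_diff_def sum.atMost_Suc_shift del: sum.atMost_Suc)
  finally show ?thesis by (simp add: fwd_diff_diff)
qed

lemma fwd_diff_partial_sum: "fwd_diff (\<lambda>a. \<Sum>s<a. f s) (Suc i) = fwd_diff f i"
  by (simp add: fwd_diff_Suc)

lemma fwd_diff_binomial:
  "fwd_diff (\<lambda>a. real ((a + p) choose m)) i = (if i \<le> m then real (p choose (m - i)) else 0)"
proof (induction i arbitrary: m)
  case 0
  then show ?case by simp
next
  case (Suc i)
  show ?case
  proof (cases m)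
    case 0
    then show ?thesis by (simp add: fwd_diff_Suc)
  next
    case (Suc m')
    then show ?thesis using Suc.IH[of m'] by (simp add: fwd_diff_Suc)
  qed
qed

definition fwd_diff2 :: "(nat \<Rightarrow> nat \<Rightarrow> real) \<Rightarrow> nat \<Rightarrow> nat \<Rightarrow> real" where
  "fwd_diff2 f i j = (\<Sum>a\<le>i. \<Sum>b\<le>j.
      (-1) ^ (i - a + (j - b)) * real (i choose a) * real (j choose b) * f a b)"

lemma fwd_diff2_iterated: "fwd_diff2 f i j = fwd_diff (\<lambda>a. fwd_diff (f a) j) i"
  unfolding fwd_diff2_def fwd_diff_def sum_distrib_left
  by (intro sum.cong refl) (simp only: power_add mult_ac)

lemma fwd_diff2_add: "fwd_diff2 (\<lambda>a b. f a b + g a b) i j = fwd_diff2 f i j + fwd_diff2 g i j"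
  unfolding fwd_diff2_def by (simp add: sum.distrib algebra_simps)

lemma fwd_diff2_sum:
  "finite A \<Longrightarrow> fwd_diff2 (\<lambda>a b. \<Sum>p\<in>A. f p a b) i j = (\<Sum>p\<in>A. fwd_diff2 (f p) i j)"
  unfolding fwd_diff2_iterated by (simp add: fwd_diff_sum)

lemma fwd_diff2_product: "fwd_diff2 (\<lambda>a b. f a * g b) i j = fwd_diff f i * fwd_diff g j"
  unfolding fwd_diff2_def fwd_diff_def sum_product
  by (intro sum.cong refl) (simp only: power_add mult_ac)

lemma fwd_diff2_partial_sum_left:
  "fwd_diff2 (\<lambda>a b. \<Sum>s<a. f s b) i j = (if i = 0 then 0 else fwd_diff2 f (i - 1) j)"
  unfolding fwd_diff2_iterated
  by (cases i) (simp_all add: fwd_diff_sum fwd_diff_partial_sum)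

lemma fwd_diff2_partial_sum_right:
  "fwd_diff2 (\<lambda>a b. \<Sum>v<b. f a v) i j = (if j = 0 then 0 else fwd_diff2 f i (j - 1))"
  unfolding fwd_diff2_iterated
  by (cases j) (simp_all add: fwd_diff_partial_sum)

(* In the binomial basis, the hook sum multiplies the generating function of the
   coefficients by 1 + X + Y. *)
definition hook_sum :: "(nat \<Rightarrow> nat \<Rightarrow> real) \<Rightarrow> nat \<Rightarrow> nat \<Rightarrow> real" where
  "hook_sum F t u = F t u + (\<Sum>s<t. F s u) + (\<Sum>v<u. F t v)"

lemma fwd_diff2_hook_sum:
  "fwd_diff2 (hook_sum F) i j = fwd_diff2 F i j
     + (if i = 0 then 0 else fwd_diff2 F (i - 1) j) + (if j = 0 then 0 else fwd_diff2 F i (j - 1))"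
  unfolding hook_sum_def fwd_diff2_add fwd_diff2_partial_sum_left fwd_diff2_partial_sum_right ..

definition diag_conv :: "(int \<Rightarrow> real) \<Rightarrow> (int \<Rightarrow> real) \<Rightarrow> int \<Rightarrow> nat \<Rightarrow> real" where
  "diag_conv A B T U = (\<Sum>j\<le>U. A (int j) * B (int j + T - int U))"

lemma diag_conv_neg: "(\<And>x. x < 0 \<Longrightarrow> B x = 0) \<Longrightarrow> T < 0 \<Longrightarrow> diag_conv A B T U = 0"
  unfolding diag_conv_def by (intro sum.neutral) auto

lemma diag_conv_Suc: "diag_conv A B T (Suc U) = A (int (Suc U)) * B T + diag_conv A B (T - 1) U"
  unfolding diag_conv_def by (simp add: algebra_simps)

(* The diagonals through the top and right edges of [0,U] x [0,T] partition that rectangle. *)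
lemma hook_sum_diag_conv:
  assumes B: "\<And>x. x < 0 \<Longrightarrow> B x = 0"
  shows "hook_sum (\<lambda>s v. diag_conv A B (int s) v) T U = (\<Sum>j\<le>U. A (int j)) * (\<Sum>l\<le>T. B (int l))"
  unfolding hook_sum_def
proof (induction U)
  case 0
  show ?case
    by (simp add: diag_conv_def lessThan_Suc_atMost[symmetric] sum_distrib_left algebra_simps)
next
  case (Suc U)
  have shift: "(\<Sum>s<T. diag_conv A B (int s - 1) U)
      = (\<Sum>s<T. diag_conv A B (int s) U) - diag_conv A B (int T - 1) U"
  proof -
    have "(\<Sum>s<T. diag_conv A B (int (Suc s) - 1) U - diag_conv A B (int s - 1) U)
        = diag_conv A B (int T - 1) U - diag_conv A B (int 0 - 1) U"
      by (rule sum_lessThan_telescope)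
    moreover have "diag_conv A B (int 0 - 1) U = 0" using B by (intro diag_conv_neg) auto
    ultimately show ?thesis by (simp add: sum_subtractf)
  qed
  have "diag_conv A B (int T) (Suc U) + (\<Sum>s<T. diag_conv A B (int s) (Suc U))
        + (\<Sum>v<Suc U. diag_conv A B (int T) v)
      = A (int (Suc U)) * (\<Sum>l\<le>T. B (int l))
        + (diag_conv A B (int T) U + (\<Sum>s<T. diag_conv A B (int s) U)
           + (\<Sum>v<U. diag_conv A B (int T) v))"
    by (simp add: diag_conv_Suc sum.distrib sum_distrib_left shift
        lessThan_Suc_atMost[symmetric] algebra_simps)
  also have "\<dots> = (\<Sum>j\<le>Suc U. A (int j)) * (\<Sum>l\<le>T. B (int l))"
    unfolding Suc by (simp add: algebra_simps)
  finally show ?case .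
qed

lemma sum_lessThan_shift:
  fixes f :: "nat \<Rightarrow> 'a::comm_monoid_add"
  assumes "a \<le> t" and "\<And>s. s < a \<Longrightarrow> f s = 0"
  shows "(\<Sum>s<t. f s) = (\<Sum>s<t - a. f (s + a))"
proof -
  have "(\<Sum>s<t. f s) = (\<Sum>s\<in>{a..<t}. f s)"
    using assms by (intro sum.mono_neutral_right) auto
  also have "\<dots> = (\<Sum>s<t - a. f (s + a))"
    by (simp add: sum.atLeastLessThan_shift_0 atLeast0LessThan add.commute)
  finally show ?thesis .
qed

lemma hook_sum_shift:
  "hook_sum (\<lambda>s v. if s < a \<or> v < b then 0 else F (s - a) (v - b)) t u
     = (if t < a \<or> u < b then 0 else hook_sum F (t - a) (u - b))"
proof (cases "t < a \<or> u < b")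
  case True
  then show ?thesis by (auto simp: hook_sum_def intro!: sum.neutral)
next
  case False
  then have "a \<le> t" "b \<le> u" by auto
  then show ?thesis unfolding hook_sum_def
    by (simp add: sum_lessThan_shift[of a t] sum_lessThan_shift[of b u])
qed

lemma hook_sum_sum:
  "finite A \<Longrightarrow> hook_sum (\<lambda>s v. \<Sum>p\<in>A. F p s v) t u = (\<Sum>p\<in>A. hook_sum (F p) t u)"
  unfolding hook_sum_def by (simp add: sum.distrib sum.swap[of _ A])

section \<open>Division of power series by 1 + X + Y\<close>

definition hom_part :: "(nat \<Rightarrow> nat \<Rightarrow> real) \<Rightarrow> nat \<Rightarrow> real \<Rightarrow> real \<Rightarrow> real" where
  "hom_part c k X Y = (\<Sum>i\<le>k. c i (k - i) * X ^ i * Y ^ (k - i))"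

lemma hom_part_scale: "hom_part c k (s * X) (s * Y) = s ^ k * hom_part c k X Y"
  unfolding hom_part_def sum_distrib_left
proof (intro sum.cong refl)
  fix i assume "i \<in> {..k}"
  then have "s ^ k = s ^ i * s ^ (k - i)" by (simp flip: power_add)
  then show "c i (k - i) * (s * X) ^ i * (s * Y) ^ (k - i) = s ^ k * (c i (k - i) * X ^ i * Y ^ (k - i))"
    by (simp add: power_mult_distrib)
qed

(* g is the coefficient array of (1 + X + Y) * C, where C has coefficients c. *)
locale trinomial_multiple =
  fixes c g :: "nat \<Rightarrow> nat \<Rightarrow> real"
  assumes g_eq: "\<And>i j. g i j = c i j + (if i = 0 then 0 else c (i - 1) j) + (if j = 0 then 0 else c i (j - 1))"
begin

lemma hom_part_Suc: "hom_part g (Suc k) X Y = hom_part c (Suc k) X Y + (X + Y) * hom_part c k X Y"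
proof -
  have "hom_part g (Suc k) X Y = hom_part c (Suc k) X Y
     + (\<Sum>i\<le>Suc k. (if i = 0 then 0 else c (i - 1) (Suc k - i)) * X ^ i * Y ^ (Suc k - i))
     + (\<Sum>i\<le>Suc k. (if Suc k - i = 0 then 0 else c i (Suc k - i - 1)) * X ^ i * Y ^ (Suc k - i))"
    unfolding hom_part_def g_eq by (simp add: sum.distrib algebra_simps)
  also have "(\<Sum>i\<le>Suc k. (if i = 0 then 0 else c (i - 1) (Suc k - i)) * X ^ i * Y ^ (Suc k - i))
      = X * hom_part c k X Y"
    unfolding hom_part_def sum.atMost_Suc_shift by (simp add: sum_distrib_left algebra_simps)
  also have "(\<Sum>i\<le>Suc k. (if Suc k - i = 0 then 0 else c i (Suc k - i - 1)) * X ^ i * Y ^ (Suc k - i))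
      = Y * hom_part c k X Y"
    unfolding hom_part_def by (simp add: Suc_diff_le sum_distrib_left algebra_simps)
  finally show ?thesis by (simp add: algebra_simps)
qed

lemma hom_part_c_eq: "hom_part c k X Y = (\<Sum>l\<le>k. (-(X + Y)) ^ (k - l) * hom_part g l X Y)"
proof (induction k)
  case 0
  then show ?case by (simp add: hom_part_def g_eq)
next
  case (Suc k)
  have "hom_part c (Suc k) X Y = hom_part g (Suc k) X Y + (-(X + Y)) * hom_part c k X Y"
    by (simp add: hom_part_Suc algebra_simps)
  also have "\<dots> = (\<Sum>l\<le>Suc k. (-(X + Y)) ^ (Suc k - l) * hom_part g l X Y)"
    unfolding Suc sum_distrib_left by (simp add: Suc_diff_le mult.assoc)
  finally show ?case .
qed

end

(* If the polynomial with coefficients g has degree at most n and vanishes on X + Y = -1,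
   it is divisible by 1 + X + Y; the quotient has degree below n and equals C. *)
locale trinomial_multiple_poly = trinomial_multiple +
  fixes n :: nat
  assumes g_vanishes: "\<And>i j. n < i + j \<Longrightarrow> g i j = 0"
    and g_root: "\<And>X Y. X + Y = -1 \<Longrightarrow> (\<Sum>i\<le>n. \<Sum>j\<le>n. g i j * X ^ i * Y ^ j) = 0"
begin

lemma hom_part_g_vanishes: "n < l \<Longrightarrow> hom_part g l X Y = 0"
  unfolding hom_part_def by (intro sum.neutral) (auto simp: g_vanishes)

lemma poly_g_eq_sum_hom_part: "(\<Sum>i\<le>n. \<Sum>j\<le>n. g i j * X ^ i * Y ^ j) = (\<Sum>l\<le>n. hom_part g l X Y)"
proof -
  have "(\<Sum>i\<le>n. \<Sum>j\<le>n. g i j * X ^ i * Y ^ j) = (\<Sum>(i, j)\<in>{..n} \<times> {..n}. g i j * X ^ i * Y ^ j)"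
    by (simp add: sum.cartesian_product)
  also have "\<dots> = (\<Sum>(i, j)\<in>{(i, j). i + j \<le> n}. g i j * X ^ i * Y ^ j)"
    by (rule sum.mono_neutral_right) (auto, metis g_vanishes not_le)
  also have "\<dots> = (\<Sum>l\<le>n. hom_part g l X Y)"
    unfolding hom_part_def by (rule sum.triangle_reindex_eq)
  finally show ?thesis .
qed

(* With s = -(X + Y), the components of C of degree at least n are multiples of the
   g-polynomial at (X/s, Y/s), a point of the line X + Y = -1. *)
lemma hom_part_c_vanishes:
  assumes "n \<le> k" and "X + Y \<noteq> 0"
  shows "hom_part c k X Y = 0"
proof -
  define s where "s = - (X + Y)"
  have "s \<noteq> 0" using assms(2) by (simp add: s_def)
  have "hom_part c k X Y = (\<Sum>l\<le>n. s ^ (k - l) * hom_part g l X Y)"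
    unfolding hom_part_c_eq s_def
    by (rule sum.mono_neutral_right) (use assms(1) in \<open>auto simp: hom_part_g_vanishes\<close>)
  also have "\<dots> = s ^ k * (\<Sum>l\<le>n. hom_part g l (X / s) (Y / s))"
    unfolding sum_distrib_left
  proof (intro sum.cong refl)
    fix l assume "l \<in> {..n}"
    then have "s ^ k = s ^ (k - l) * s ^ l" using assms(1) by (simp flip: power_add)
    then show "s ^ (k - l) * hom_part g l X Y = s ^ k * hom_part g l (X / s) (Y / s)"
      using hom_part_scale[of g l "1 / s" X Y] \<open>s \<noteq> 0\<close> by (simp add: power_divide)
  qed
  also have "(\<Sum>l\<le>n. hom_part g l (X / s) (Y / s)) = 0"
  proof -
    have "X + Y = - s" by (simp add: s_def)
    then have "X / s + Y / s = -1" using \<open>s \<noteq> 0\<close> by (simp flip: add_divide_distrib)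
    then show ?thesis using g_root by (simp add: poly_g_eq_sum_hom_part)
  qed
  finally show ?thesis by simp
qed

lemma c_vanishes:
  assumes "n \<le> i + j"
  shows "c i j = 0"
proof -
  define p where "p = (\<Sum>a\<le>i + j. monom (c a (i + j - a)) a)"
  have "poly p X = hom_part c (i + j) X 1" for X
    unfolding p_def hom_part_def by (simp add: poly_sum poly_monom)
  then have "{X. X \<noteq> -1} \<subseteq> {X. poly p X = 0}"
    using hom_part_c_vanishes[OF assms] by auto
  moreover have "infinite {X :: real. X \<noteq> -1}"
  proof -
    have "infinite (UNIV - {-1 :: real})"
      by (rule Diff_infinite_finite) (simp_all add: infinite_UNIV_char_0)
    then show ?thesis by (simp add: set_diff_eq)
  qed
  ultimately have "p = 0" using poly_roots_finite finite_subset by blast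
  then have "coeff p i = 0" by simp
  then show ?thesis unfolding p_def by (simp add: coeff_sum coeff_monom)
qed

lemma poly_c_times_trinomial:
  "(\<Sum>i<n. \<Sum>j<n. c i j * X ^ i * Y ^ j) * (1 + X + Y) = (\<Sum>i\<le>n. \<Sum>j\<le>n. g i j * X ^ i * Y ^ j)"
proof (cases n)
  case 0
  then show ?thesis by (simp add: g_eq c_vanishes)
next
  case (Suc m)
  define S where "S = (\<Sum>i\<le>m. \<Sum>j\<le>m. c i j * X ^ i * Y ^ j)"
  have border: "c i (Suc m) = 0" "c (Suc m) j = 0" for i j
    using c_vanishes Suc by auto
  have "(\<Sum>i\<le>n. \<Sum>j\<le>n. c i j * X ^ i * Y ^ j) = S"
    by (simp add: S_def Suc border)
  moreover have "(\<Sum>i\<le>n. \<Sum>j\<le>n. (if i = 0 then 0 else c (i - 1) j) * X ^ i * Y ^ j) = X * S"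
  proof -
    have "(\<Sum>i\<le>n. \<Sum>j\<le>n. (if i = 0 then 0 else c (i - 1) j) * X ^ i * Y ^ j)
        = (\<Sum>i\<le>m. \<Sum>j\<le>n. c i j * X ^ Suc i * Y ^ j)"
      unfolding Suc sum.atMost_Suc_shift by simp
    then show ?thesis by (simp add: S_def Suc border sum_distrib_left algebra_simps)
  qed
  moreover have "(\<Sum>i\<le>n. \<Sum>j\<le>n. (if j = 0 then 0 else c i (j - 1)) * X ^ i * Y ^ j) = Y * S"
  proof -
    have "(\<Sum>i\<le>n. \<Sum>j\<le>n. (if j = 0 then 0 else c i (j - 1)) * X ^ i * Y ^ j)
        = (\<Sum>i\<le>n. \<Sum>j\<le>m. c i j * X ^ i * Y ^ Suc j)"
      unfolding Suc sum.atMost_Suc_shift by simp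
    then show ?thesis by (simp add: S_def Suc border sum_distrib_left algebra_simps)
  qed
  ultimately show ?thesis
    unfolding g_eq by (simp add: S_def Suc sum.distrib lessThan_Suc_atMost algebra_simps)
qed

end

section \<open>Counting integer vectors with a given sign pattern\<close>

lemma sum_add_sum_Compl: "sum f (P :: 'n::finite set) + sum f (- P) = sum f UNIV"
  using sum.union_disjoint[of P "- P" f] by (simp add: Compl_partition)

lemma card_add_card_Compl: "card (P :: 'n::finite set) + card (- P) = CARD('n)"
  using card_Un_disjoint[of P "- P"] by (simp add: Compl_partition)

(* The number of multisets of size x over k elements, extended by 0 to negative x. *)
definition msets_count :: "nat \<Rightarrow> int \<Rightarrow> real" where
  "msets_count k x = (if x < 0 then 0 else real ((k + nat x - 1) choose nat x))"

lemma msets_count_neg: "x < 0 \<Longrightarrow> msets_count k x = 0"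
  by (simp add: msets_count_def)

lemma msets_count_card: "finite A \<Longrightarrow> msets_count (card A) (int n) = real (card (multisets_of_size A n))"
  by (simp add: msets_count_def card_multisets_of_size)

lemma sum_msets_count: "(\<Sum>j\<le>U. msets_count k (int j)) = real ((U + k) choose k)"
proof (cases k)
  case 0
  then have "(\<Sum>j\<le>U. msets_count k (int j)) = (\<Sum>j\<le>U. if j = 0 then 1 else 0)"
    by (intro sum.cong refl) (auto simp: msets_count_def)
  then show ?thesis using 0 by simp
next
  case (Suc b)
  then have "(\<Sum>j\<le>U. msets_count k (int j)) = real (\<Sum>j\<le>U. (b + j) choose j)"
    by (simp add: msets_count_def add.commute)
  also have "\<dots> = real (Suc (b + U) choose U)"
    by (simp only: sum_choose_lower)
  also have "Suc (b + U) choose U = (U + k) choose k"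
    using Suc binomial_symmetric[of U "U + k"] by (simp add: add.commute)
  finally show ?thesis .
qed

lemma sum_count_eq_size:
  assumes "finite A" and "set_mset M \<subseteq> A"
  shows "sum (count M) A = size M"
proof -
  have "sum (count M) A = sum (count M) (set_mset M)"
    using assms by (intro sum.mono_neutral_right) (auto simp: not_in_iff)
  then show ?thesis by (simp add: size_multiset_overloaded_eq)
qed

(* The multisets z - 1 on P and -z off P have sizes j and l. *)
definition sign_class :: "'n::finite set \<Rightarrow> nat \<Rightarrow> nat \<Rightarrow> ('n \<Rightarrow> int) set" where
  "sign_class P j l =
     {z. {i. 0 < z i} = P \<and> sum z P = int (j + card P) \<and> sum z (- P) = - int l}"

lemma bij_betw_sign_class:
  fixes P :: "'n::finite set"
  shows "bij_betw (\<lambda>(a, b) i. if i \<in> P then int (count a i) + 1 else - int (count b i))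
     (multisets_of_size P j \<times> multisets_of_size (- P) l) (sign_class P j l)"
proof (rule bij_betw_byWitness)
  let ?f = "\<lambda>(a, b) (i :: 'n). if i \<in> P then int (count a i) + 1 else - int (count b i)"
  let ?g = "\<lambda>z :: 'n \<Rightarrow> int. (Abs_multiset (\<lambda>i. if i \<in> P then nat (z i - 1) else 0),
                  Abs_multiset (\<lambda>i. if i \<in> P then 0 else nat (- z i)))"
  have count_g: "count (fst (?g z)) = (\<lambda>i. if i \<in> P then nat (z i - 1) else 0)"
    "count (snd (?g z)) = (\<lambda>i. if i \<in> P then 0 else nat (- z i))" for z :: "'n \<Rightarrow> int"
    by (simp_all add: count_Abs_multiset)
  show "\<forall>ab \<in> multisets_of_size P j \<times> multisets_of_size (- P) l. ?g (?f ab) = ab"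
    by (auto simp: multisets_of_size_def count_Abs_multiset not_in_iff[symmetric] intro!: multiset_eqI)
  show "\<forall>z \<in> sign_class P j l. ?f (?g z) = z"
    by (auto simp: sign_class_def count_g)
  show "?f ` (multisets_of_size P j \<times> multisets_of_size (- P) l) \<subseteq> sign_class P j l"
  proof clarify
    fix a b assume "a \<in> multisets_of_size P j" "b \<in> multisets_of_size (- P) l"
    then have "sum (count a) P = j" "sum (count b) (- P) = l"
      by (simp_all add: multisets_of_size_def sum_count_eq_size)
    then show "(\<lambda>i. if i \<in> P then int (count a i) + 1 else - int (count b i)) \<in> sign_class P j l"
      by (auto simp: sign_class_def sum.distrib sum_negf simp flip: of_nat_sum)
  qed
  show "?g ` sign_class P j l \<subseteq> multisets_of_size P j \<times> multisets_of_size (- P) l"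
  proof (rule image_subsetI)
    fix z assume z: "z \<in> sign_class P j l"
    then have pos: "i \<in> P \<longleftrightarrow> 0 < z i" for i by (auto simp: sign_class_def)
    let ?a = "fst (?g z)" and ?b = "snd (?g z)"
    have supp: "set_mset ?a \<subseteq> P" "set_mset ?b \<subseteq> - P"
      by (auto simp: count_g split: if_splits simp flip: count_greater_zero_iff)
    have "int (sum (count ?a) P) = (\<Sum>i\<in>P. z i - 1)"
      unfolding count_g of_nat_sum by (intro sum.cong) (auto simp: pos)
    also have "\<dots> = int j"
      using z by (simp add: sign_class_def sum_subtractf)
    finally have "size ?a = j"
      using sum_count_eq_size[OF finite supp(1)] by (simp only: of_nat_eq_iff)
    moreover have "size ?b = l"
    proof -
      have "int (sum (count ?b) (- P)) = (\<Sum>i\<in>- P. - z i)"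
        unfolding count_g of_nat_sum by (intro sum.cong) (auto simp: pos)
      also have "\<dots> = int l"
        using z by (simp add: sign_class_def sum_negf)
      finally show ?thesis
        using sum_count_eq_size[OF finite supp(2)] by (simp only: of_nat_eq_iff)
    qed
    ultimately show "?g z \<in> multisets_of_size P j \<times> multisets_of_size (- P) l"
      using supp by (simp add: multisets_of_size_def)
  qed
qed

lemma finite_sign_class: "finite (sign_class P j l)"
  using bij_betw_finite[OF bij_betw_sign_class] by (simp add: finite_multisets_of_size)

lemma card_sign_class:
  "card (sign_class P j l) = card (multisets_of_size P j) * card (multisets_of_size (- P) l)"
  unfolding card_cartesian_product[symmetric]
  by (rule bij_betw_same_card[OF bij_betw_sign_class, symmetric])

section \<open>Matroid rank functions\<close>

locale matroid =
  fixes r :: "'n::finite set \<Rightarrow> nat"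
  assumes matroid_rank: "matroid_rank r"
begin

lemma rank_le_card: "r S \<le> card S"
  using matroid_rank by (simp add: matroid_rank_def)

lemma rank_mono: "S \<subseteq> T \<Longrightarrow> r S \<le> r T"
  using matroid_rank by (simp add: matroid_rank_def)

lemma rank_submodular: "r (S \<union> T) + r (S \<inter> T) \<le> r S + r T"
  using matroid_rank by (simp add: matroid_rank_def)

lemma rank_empty [simp]: "r {} = 0"
  using rank_le_card[of "{}"] by simp

lemma rank_le_rank_UNIV: "r S \<le> r UNIV"
  by (rule rank_mono) simp

lemma rank_insert_le: "r (insert e S) \<le> Suc (r S)"
  using rank_submodular[of S "{e}"] rank_le_card[of "{e}"] by simp

lemma rank_UNIV_le: "r UNIV \<le> r P + card (- P)"
  using rank_submodular[of P "- P"] rank_le_card[of "- P"] by simp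

lemma indep_subset:
  assumes I: "r I = card I" and "J \<subseteq> I"
  shows "r J = card J"
proof -
  have "card I = card J + card (I - J)"
    using \<open>J \<subseteq> I\<close> by (simp add: card_Diff_subset card_mono)
  moreover have "r I \<le> r J + r (I - J)"
    using rank_submodular[of J "I - J"] \<open>J \<subseteq> I\<close> by (simp add: Un_absorb1 Int_Diff)
  ultimately have "card J \<le> r J"
    using I rank_le_card[of "I - J"] by simp
  then show ?thesis using rank_le_card[of J] by simp
qed

lemma indep_extend:
  assumes I: "r I = card I" "I \<subseteq> S" "r I = r S"
  shows "\<exists>J. I \<subseteq> J \<and> J \<subseteq> S \<union> T \<and> r J = card J \<and> r J = r (S \<union> T)"
proof -
  have "finite T" by simp
  then show ?thesis
  proof (induction T rule: finite_induct)
    case empty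
    then show ?case using I by auto
  next
    case (insert e T)
    then obtain J where J: "I \<subseteq> J" "J \<subseteq> S \<union> T" "r J = card J" "r J = r (S \<union> T)"
      by blast
    show ?case
    proof (cases "r (S \<union> insert e T) = r (S \<union> T)")
      case True
      then show ?thesis using J by auto
    next
      case False
      have "r (S \<union> T) \<le> r (S \<union> insert e T)"
        by (rule rank_mono) auto
      then have up: "r (S \<union> insert e T) = Suc (r (S \<union> T))"
        using False rank_insert_le[of e "S \<union> T"] by simp
      have e: "e \<notin> S \<union> T"
        using False by (metis Un_insert_right insert_absorb)
      \<comment> \<open>Submodularity for J + e and S \<union> T, which meet in J.\<close>
      have "r (S \<union> insert e T) + r J \<le> r (insert e J) + r (S \<union> T)"
        using rank_submodular[of "insert e J" "S \<union> T"] J e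
        by (simp add: Un_absorb1 insert_absorb Int_insert_left Int_absorb2 Un_commute Un_insert_left
            Un_left_commute)
      moreover have card_eJ: "card (insert e J) = Suc (card J)"
        using e J by (subst card_insert_disjoint) auto
      ultimately have indep: "r (insert e J) = card (insert e J)"
        using up J rank_le_card[of "insert e J"] by simp
      moreover have "r (insert e J) = r (S \<union> insert e T)"
        using indep up J card_eJ by simp
      ultimately show ?thesis using J by (intro exI[of _ "insert e J"]) auto
    qed
  qed
qed

lemma exists_basis_meeting: "\<exists>B. r B = card B \<and> card B = r UNIV \<and> r P \<le> card (B \<inter> P)"
proof -
  obtain I where I: "I \<subseteq> P" "r I = card I" "r I = r P"
    using indep_extend[of "{}" "{}" P] by auto
  obtain B where B: "I \<subseteq> B" "r B = card B" "r B = r UNIV"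
    using indep_extend[of I P UNIV] I by auto
  have "card I \<le> card (B \<inter> P)" using I B by (intro card_mono) auto
  then show ?thesis using B I by (intro exI[of _ B]) auto
qed

end

section \<open>Lattice points of the Minkowski sum\<close>

definition of_int_vec :: "('n::finite \<Rightarrow> int) \<Rightarrow> real ^ 'n" where
  "of_int_vec z = (\<chi> i. of_int (z i))"

lemma of_int_vec_nth [simp]: "of_int_vec z $ i = of_int (z i)"
  by (simp add: of_int_vec_def)

lemma inj_of_int_vec: "inj of_int_vec"
  by (intro injI) (simp add: vec_eq_iff fun_eq_iff)

lemma of_int_vec_in_int_points: "of_int_vec z \<in> int_points"
  by (simp add: int_points_def)

definition mink_sum :: "('n::finite set \<Rightarrow> nat) \<Rightarrow> nat \<Rightarrow> nat \<Rightarrow> (real ^ 'n) set" where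
  "mink_sum r t u = {p + q + s | p q s. p \<in> base_polytope r \<and> q \<in> (*\<^sub>R) (real u) ` simplex_Delta
                        \<and> s \<in> (*\<^sub>R) (real t) ` simplex_Nabla}"

lemma QM_eq_card_mink_sum: "QM r t u = card (int_points \<inter> mink_sum r t u)"
  by (simp add: QM_def mink_sum_def)

definition std_simplex :: "(real ^ 'n::finite) set" where
  "std_simplex = {v. (\<forall>i. 0 \<le> v $ i) \<and> (\<Sum>i\<in>UNIV. v $ i) = 1}"

lemma simplex_Delta_subset: "simplex_Delta \<subseteq> std_simplex"
  unfolding simplex_Delta_def
proof (rule hull_minimal)
  show "range (\<lambda>i. axis i 1) \<subseteq> std_simplex"
    by (auto simp: std_simplex_def axis_def if_distrib cong: if_cong)
  show "convex (std_simplex :: (real ^ 'n) set)"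
    unfolding convex_def std_simplex_def
    by (auto simp: sum.distrib sum_distrib_left[symmetric])
qed

definition base_polyhedron :: "('n::finite set \<Rightarrow> nat) \<Rightarrow> (real ^ 'n) set" where
  "base_polyhedron r =
     {v. (\<Sum>i\<in>UNIV. v $ i) = real (r UNIV) \<and> (\<forall>S. (\<Sum>i\<in>S. v $ i) \<le> real (r S))}"

lemma convex_base_polyhedron: "convex (base_polyhedron r)"
  unfolding convex_def base_polyhedron_def
proof (intro ballI allI impI CollectI conjI)
  fix x y :: "real ^ 'a" and a b :: real and S
  assume x: "x \<in> {v. (\<Sum>i\<in>UNIV. v $ i) = real (r UNIV) \<and> (\<forall>S. (\<Sum>i\<in>S. v $ i) \<le> real (r S))}"
     and y: "y \<in> {v. (\<Sum>i\<in>UNIV. v $ i) = real (r UNIV) \<and> (\<forall>S. (\<Sum>i\<in>S. v $ i) \<le> real (r S))}"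
     and ab: "0 \<le> a" "0 \<le> b" "a + b = 1"
  have sum_comb: "(\<Sum>i\<in>S. (a *\<^sub>R x + b *\<^sub>R y) $ i) = a * (\<Sum>i\<in>S. x $ i) + b * (\<Sum>i\<in>S. y $ i)"
    for S by (simp add: sum.distrib sum_distrib_left)
  show "(\<Sum>i\<in>UNIV. (a *\<^sub>R x + b *\<^sub>R y) $ i) = real (r UNIV)"
    using x y ab unfolding sum_comb by (simp add: distrib_right[symmetric])
  have "a * (\<Sum>i\<in>S. x $ i) + b * (\<Sum>i\<in>S. y $ i) \<le> a * real (r S) + b * real (r S)"
    using x y ab by (intro add_mono mult_left_mono) auto
  then show "(\<Sum>i\<in>S. (a *\<^sub>R x + b *\<^sub>R y) $ i) \<le> real (r S)"
    using ab unfolding sum_comb by (simp add: distrib_right[symmetric])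
qed

lemma base_polytope_subset: "base_polytope r \<subseteq> base_polyhedron r"
  unfolding base_polytope_def
proof (rule hull_minimal)
  show "bases_vec r \<subseteq> base_polyhedron r"
    by (auto simp: bases_vec_def base_polyhedron_def)
qed (rule convex_base_polyhedron)

lemma mink_sum_ineqs:
  assumes "x \<in> mink_sum r t u"
  shows "(\<Sum>i\<in>UNIV. x $ i) = real (r UNIV) + real u - real t"
    and "(\<Sum>i\<in>S. x $ i) \<le> real (r S) + real u"
proof -
  obtain p q s where x: "x = p + real u *\<^sub>R q - real t *\<^sub>R s"
    and p: "p \<in> base_polyhedron r" and q: "q \<in> std_simplex" and s: "s \<in> std_simplex"
    using assms base_polytope_subset simplex_Delta_subset
    unfolding mink_sum_def simplex_Nabla_def by fastforce
  have sum_x: "(\<Sum>i\<in>S. x $ i) = (\<Sum>i\<in>S. p $ i) + real u * (\<Sum>i\<in>S. q $ i) - real t * (\<Sum>i\<in>S. s $ i)"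
    for S unfolding x by (simp add: sum.distrib sum_subtractf sum_distrib_left)
  show "(\<Sum>i\<in>UNIV. x $ i) = real (r UNIV) + real u - real t"
    using p q s by (simp add: sum_x base_polyhedron_def std_simplex_def)
  have "(\<Sum>i\<in>S. q $ i) \<le> 1"
    using q sum_mono2[of UNIV S "\<lambda>i. q $ i"] by (auto simp: std_simplex_def)
  then have "real u * (\<Sum>i\<in>S. q $ i) \<le> real u"
    by (simp add: mult_left_le)
  moreover have "0 \<le> real t * (\<Sum>i\<in>S. s $ i)"
    using s by (auto simp: std_simplex_def intro!: mult_nonneg_nonneg sum_nonneg)
  moreover have "(\<Sum>i\<in>S. p $ i) \<le> real (r S)"
    using p by (simp add: base_polyhedron_def)
  ultimately show "(\<Sum>i\<in>S. x $ i) \<le> real (r S) + real u"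
    unfolding sum_x by linarith
qed

(* Among the rank inequalities, only the one for the positive support of z is needed. *)
definition lattice_points :: "('n::finite set \<Rightarrow> nat) \<Rightarrow> nat \<Rightarrow> nat \<Rightarrow> ('n \<Rightarrow> int) set" where
  "lattice_points r t u = {z. sum z UNIV = int (r UNIV) + int u - int t \<and>
      sum z {i. 0 < z i} \<le> int (r {i. 0 < z i}) + int u}"

lemma int_points_mink_sum_subset: "int_points \<inter> mink_sum r t u \<subseteq> of_int_vec ` lattice_points r t u"
proof
  fix x assume x: "x \<in> int_points \<inter> mink_sum r t u"
  define z where "z i = \<lfloor>x $ i\<rfloor>" for i
  have "x $ i = of_int (z i)" for i
    using x by (simp add: int_points_def z_def)
  then have xz: "x = of_int_vec z"
    by (simp add: vec_eq_iff)
  have "real_of_int (sum z UNIV) = real_of_int (int (r UNIV) + int u - int t)"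
    using mink_sum_ineqs(1)[of x] x by (simp add: xz)
  moreover have "real_of_int (sum z {i. 0 < z i}) \<le> real_of_int (int (r {i. 0 < z i}) + int u)"
    using mink_sum_ineqs(2)[of x r t u "{i. 0 < z i}"] x by (simp add: xz)
  ultimately have "z \<in> lattice_points r t u"
    unfolding lattice_points_def of_int_eq_iff of_int_le_iff by simp
  then show "x \<in> of_int_vec ` lattice_points r t u"
    using xz by blast
qed

lemma of_int_vec_in_scaled_Delta:
  fixes w :: "'n::finite \<Rightarrow> int"
  assumes "\<And>i. 0 \<le> w i" and "sum w UNIV = int u"
  shows "of_int_vec w \<in> (*\<^sub>R) (real u) ` simplex_Delta"
proof (cases "u = 0")
  case True
  then have "of_int_vec w = real u *\<^sub>R axis undefined 1"
    using assms sum_nonneg_eq_0_iff[of UNIV w] by (simp add: vec_eq_iff)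
  moreover have "axis undefined 1 \<in> simplex_Delta"
    unfolding simplex_Delta_def by (rule hull_inc) simp
  ultimately show ?thesis by blast
next
  case False
  define v where "v = (\<Sum>i\<in>UNIV. (of_int (w i) / real u) *\<^sub>R (axis i 1 :: real ^ 'n))"
  have "v \<in> simplex_Delta"
    unfolding v_def simplex_Delta_def
  proof (rule convex_sum)
    have "(\<Sum>i\<in>UNIV. real_of_int (w i)) = real u"
      using assms(2) by (simp flip: of_int_sum)
    then show "(\<Sum>i\<in>UNIV. of_int (w i) / real u) = 1"
      using False by (simp flip: sum_divide_distrib)
  qed (use assms(1) in \<open>auto intro: hull_inc\<close>)
  moreover have "of_int_vec w = real u *\<^sub>R v"
    using False by (simp add: vec_eq_iff v_def axis_def if_distrib cong: if_cong)
  ultimately show ?thesis by blast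
qed

lemma of_int_vec_in_scaled_Nabla:
  assumes "\<And>i. 0 \<le> w i" and "sum w UNIV = int t"
  shows "of_int_vec (\<lambda>i. - w i) \<in> (*\<^sub>R) (real t) ` simplex_Nabla"
proof -
  obtain v where v: "v \<in> simplex_Delta" "of_int_vec w = real t *\<^sub>R v"
    using of_int_vec_in_scaled_Delta[OF assms] by blast
  then have "of_int_vec (\<lambda>i. - w i) = real t *\<^sub>R (- v)"
    by (simp add: vec_eq_iff)
  moreover have "- v \<in> simplex_Nabla"
    using v(1) by (simp add: simplex_Nabla_def)
  ultimately show ?thesis by blast
qed

context matroid
begin

lemma basis_indicator_in_base_polytope:
  assumes "r B = card B" and "card B = r UNIV"
  shows "of_int_vec (\<lambda>i. if i \<in> B then 1 else 0) \<in> base_polytope r"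
  unfolding base_polytope_def
proof (rule hull_inc)
  have sum_S: "(\<Sum>i\<in>S. of_int_vec (\<lambda>i. if i \<in> B then 1 else 0) $ i) = real (card (B \<inter> S))" for S
    by (simp add: if_distrib sum.If_cases Int_commute cong: if_cong)
  have "card (B \<inter> S) \<le> r S" for S
    using indep_subset[OF assms(1), of "B \<inter> S"] rank_mono[of "B \<inter> S" S] by auto
  then show "of_int_vec (\<lambda>i. if i \<in> B then 1 else 0) \<in> bases_vec r"
    using assms unfolding bases_vec_def mem_Collect_eq sum_S by (simp add: of_int_vec_in_int_points)
qed

(* Write z = e_B + d for a basis B meeting the positive support P of z in r(P) elements.
   The positive part of d then has sum at most u, and padding both parts of d by the same
   multiple of one unit vector places them in u Delta and t Nabla. *)
lemma lattice_points_subset_mink_sum: "of_int_vec ` lattice_points r t u \<subseteq> mink_sum r t u"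
proof clarify
  fix z assume "z \<in> lattice_points r t u"
  define P where "P = {i. 0 < z i}"
  have z_UNIV: "sum z UNIV = int (r UNIV) + int u - int t" and z_P: "sum z P \<le> int (r P) + int u"
    using \<open>z \<in> lattice_points r t u\<close> unfolding lattice_points_def P_def by auto
  obtain B where B: "r B = card B" "card B = r UNIV" "r P \<le> card (B \<inter> P)"
    using exists_basis_meeting by blast
  define b where "b i = (if i \<in> B then 1 else (0::int))" for i
  define d where "d i = z i - b i" for i
  define pos where "pos i = max (d i) 0" for i
  define neg where "neg i = max (- d i) 0" for i
  define pad where "pad = int u - sum pos UNIV"
  define i0 :: 'n where "i0 = undefined"
  have "pos i = (if i \<in> P then d i else 0)" for i
    by (auto simp: pos_def d_def b_def P_def)
  then have "sum pos UNIV = sum z P - int (card (B \<inter> P))"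
    by (simp add: sum.If_cases d_def b_def sum_subtractf Int_commute)
  then have pad_nonneg: "0 \<le> pad"
    using z_P B(3) by (simp add: pad_def)
  have pos_neg: "pos i - neg i = d i" for i
    by (simp add: pos_def neg_def max_def)
  then have "sum pos UNIV - sum neg UNIV = sum d UNIV"
    by (simp flip: sum_subtractf)
  also have "\<dots> = int u - int t"
    using z_UNIV B(2) by (simp add: d_def b_def sum_subtractf sum.If_cases)
  finally have sum_neg: "sum neg UNIV + pad = int t"
    by (simp add: pad_def)
  have "of_int_vec z = of_int_vec b + of_int_vec (\<lambda>i. pos i + (if i = i0 then pad else 0))
      + of_int_vec (\<lambda>i. - (neg i + (if i = i0 then pad else 0)))"
  proof -
    have "z i = b i + (pos i + (if i = i0 then pad else 0)) + - (neg i + (if i = i0 then pad else 0))" for i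
      using pos_neg[of i] by (simp add: d_def)
    then show ?thesis by (simp add: vec_eq_iff)
  qed
  moreover have "of_int_vec b \<in> base_polytope r"
    unfolding b_def using basis_indicator_in_base_polytope[OF B(1,2)] by simp
  moreover have "of_int_vec (\<lambda>i. pos i + (if i = i0 then pad else 0)) \<in> (*\<^sub>R) (real u) ` simplex_Delta"
    using pad_nonneg by (intro of_int_vec_in_scaled_Delta) (simp_all add: pos_def sum.distrib pad_def)
  moreover have "of_int_vec (\<lambda>i. - (neg i + (if i = i0 then pad else 0))) \<in> (*\<^sub>R) (real t) ` simplex_Nabla"
    using pad_nonneg sum_neg by (intro of_int_vec_in_scaled_Nabla) (simp_all add: neg_def sum.distrib)
  ultimately show "of_int_vec z \<in> mink_sum r t u"
    unfolding mink_sum_def by blast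
qed

lemma QM_eq_card_lattice_points: "QM r t u = card (lattice_points r t u)"
proof -
  have "int_points \<inter> mink_sum r t u = of_int_vec ` lattice_points r t u"
    using int_points_mink_sum_subset lattice_points_subset_mink_sum of_int_vec_in_int_points by blast
  then show ?thesis
    unfolding QM_eq_card_mink_sum by (simp add: card_image inj_on_subset[OF inj_of_int_vec])
qed

end

section \<open>Counting lattice points by their positive support\<close>

definition positive_class :: "('n::finite set \<Rightarrow> nat) \<Rightarrow> 'n set \<Rightarrow> nat \<Rightarrow> nat \<Rightarrow> ('n \<Rightarrow> int) set" where
  "positive_class r P t u = {z \<in> lattice_points r t u. {i. 0 < z i} = P}"

lemma positive_class_eq:
  "positive_class r P t u =
     (\<Union>j \<in> {j. j + card P \<le> r P + u \<and> r UNIV + u \<le> j + card P + t}.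
        sign_class P j (j + card P + t - (r UNIV + u)))"
proof (intro equalityI subsetI)
  fix z assume "z \<in> positive_class r P t u"
  then have z: "sum z UNIV = int (r UNIV) + int u - int t" "sum z P \<le> int (r P) + int u"
    and P: "{i. 0 < z i} = P"
    by (auto simp: positive_class_def lattice_points_def)
  have "int (card P) \<le> sum z P"
    using sum_mono[of P "\<lambda>_. 1" z] P by auto
  then obtain j where j: "sum z P = int (j + card P)"
    by (metis add.commute le_iff_add of_nat_add nat_int zle_iff_zadd)
  have "sum z (- P) \<le> 0"
    using P by (intro sum_nonpos) auto
  then have "z \<in> sign_class P j (j + card P + t - (r UNIV + u))"
    using z j P sum_add_sum_Compl[of z P] by (simp add: sign_class_def)
  moreover have "j + card P \<le> r P + u \<and> r UNIV + u \<le> j + card P + t"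
    using z j \<open>sum z (- P) \<le> 0\<close> sum_add_sum_Compl[of z P] by linarith
  ultimately show "z \<in> (\<Union>j \<in> {j. j + card P \<le> r P + u \<and> r UNIV + u \<le> j + card P + t}.
        sign_class P j (j + card P + t - (r UNIV + u)))"
    by blast
next
  fix z assume "z \<in> (\<Union>j \<in> {j. j + card P \<le> r P + u \<and> r UNIV + u \<le> j + card P + t}.
        sign_class P j (j + card P + t - (r UNIV + u)))"
  then obtain j where j: "j + card P \<le> r P + u" "r UNIV + u \<le> j + card P + t"
    and z: "z \<in> sign_class P j (j + card P + t - (r UNIV + u))"
    by blast
  show "z \<in> positive_class r P t u"
    using j z sum_add_sum_Compl[of z P] by (simp add: positive_class_def lattice_points_def sign_class_def)
qed

lemma finite_positive_class: "finite (positive_class r P t u)"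
proof -
  have "finite {j. j + card P \<le> r P + u \<and> r UNIV + u \<le> j + card P + t}"
    by (rule finite_subset[of _ "{..r P + u}"]) auto
  then show ?thesis
    unfolding positive_class_eq by (intro finite_UN_I finite_sign_class)
qed

lemma card_positive_class:
  "real (card (positive_class r P t u)) =
     (\<Sum>j | j + card P \<le> r P + u \<and> r UNIV + u \<le> j + card P + t.
        msets_count (card P) (int j) * msets_count (card (- P)) (int (j + card P + t - (r UNIV + u))))"
proof -
  have "real (card (positive_class r P t u)) =
      real (\<Sum>j | j + card P \<le> r P + u \<and> r UNIV + u \<le> j + card P + t.
         card (sign_class P j (j + card P + t - (r UNIV + u))))"
    unfolding positive_class_eq
  proof (rule arg_cong[where f = real], rule card_UN_disjoint)
    show "finite {j. j + card P \<le> r P + u \<and> r UNIV + u \<le> j + card P + t}"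
      by (rule finite_subset[of _ "{..r P + u}"]) auto
  qed (simp add: finite_sign_class, auto simp: sign_class_def)
  also have "\<dots> = (\<Sum>j | j + card P \<le> r P + u \<and> r UNIV + u \<le> j + card P + t.
     msets_count (card P) (int j) * msets_count (card (- P)) (int (j + card P + t - (r UNIV + u))))"
    unfolding of_nat_sum
    by (intro sum.cong refl) (simp only: card_sign_class of_nat_mult msets_count_card[OF finite])
  finally show ?thesis .
qed

context matroid
begin

lemma card_positive_class_diag_conv:
  "real (card (positive_class r P t u)) =
     (if t < r UNIV - r P \<or> u < card P - r P then 0
      else diag_conv (msets_count (card P)) (msets_count (card (- P)))
             (int (t - (r UNIV - r P))) (u - (card P - r P)))"
proof -
  let ?J = "{j. j + card P \<le> r P + u \<and> r UNIV + u \<le> j + card P + t}"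
  have rP: "r P \<le> card P" "r P \<le> r UNIV"
    by (simp_all add: rank_le_card rank_le_rank_UNIV)
  show ?thesis
  proof (cases "t < r UNIV - r P \<or> u < card P - r P")
    case True
    then have "?J = {}" using rP by auto
    then show ?thesis
      using True by (simp only: card_positive_class sum.empty) simp
  next
    case False
    have "(\<Sum>j\<in>?J. msets_count (card P) (int j) * msets_count (card (- P)) (int (j + card P + t - (r UNIV + u))))
        = (\<Sum>j\<le>u - (card P - r P). msets_count (card P) (int j) *
             msets_count (card (- P)) (int j + int (t - (r UNIV - r P)) - int (u - (card P - r P))))"
    proof (rule sum.mono_neutral_cong_left)
      show "?J \<subseteq> {..u - (card P - r P)}" using rP by auto
      show "\<forall>j \<in> {..u - (card P - r P)} - ?J. msets_count (card P) (int j) *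
          msets_count (card (- P)) (int j + int (t - (r UNIV - r P)) - int (u - (card P - r P))) = 0"
        using False rP by (auto simp: msets_count_def)
      show "msets_count (card P) (int j) * msets_count (card (- P)) (int (j + card P + t - (r UNIV + u)))
          = msets_count (card P) (int j) *
            msets_count (card (- P)) (int j + int (t - (r UNIV - r P)) - int (u - (card P - r P)))"
        if "j \<in> ?J" for j
      proof -
        have "int (j + card P + t - (r UNIV + u)) = int j + int (t - (r UNIV - r P)) - int (u - (card P - r P))"
          using that False rP by (simp add: of_nat_diff)
        then show ?thesis by (simp only:)
      qed
    qed simp
    then show ?thesis
      using False by (simp add: card_positive_class diag_conv_def)
  qed
qed

lemma hook_sum_positive_class:
  "hook_sum (\<lambda>s v. real (card (positive_class r P s v))) t u =
     real ((t + (card (- P) - (r UNIV - r P))) choose card (- P)) * real ((u + r P) choose card P)"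
proof -
  let ?c = "r UNIV - r P" and ?\<nu> = "card P - r P"
  have rP: "r P \<le> card P" "?c \<le> card (- P)"
    using rank_le_card rank_UNIV_le[of P] by auto
  have "hook_sum (\<lambda>s v. real (card (positive_class r P s v))) t u
      = (if t < ?c \<or> u < ?\<nu> then 0
         else hook_sum (\<lambda>s v. diag_conv (msets_count (card P)) (msets_count (card (- P))) (int s) v)
                (t - ?c) (u - ?\<nu>))"
    unfolding card_positive_class_diag_conv by (rule hook_sum_shift)
  also have "\<dots> = real ((t + (card (- P) - ?c)) choose card (- P)) * real ((u + r P) choose card P)"
  proof (cases "t < ?c \<or> u < ?\<nu>")
    case True
    then have "t + (card (- P) - ?c) < card (- P) \<or> u + r P < card P"
      using rP by linarith
    then show ?thesis using True by auto
  next
    case False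
    then have "u - ?\<nu> + card P = u + r P" "t - ?c + card (- P) = t + (card (- P) - ?c)"
      using rP by auto
    then have "hook_sum (\<lambda>s v. diag_conv (msets_count (card P)) (msets_count (card (- P))) (int s) v)
        (t - ?c) (u - ?\<nu>) = real ((u + r P) choose card P) * real ((t + (card (- P) - ?c)) choose card (- P))"
      by (simp only: hook_sum_diag_conv[OF msets_count_neg] sum_msets_count)
    then show ?thesis
      using False by (simp only: if_False mult.commute)
  qed
  finally show ?thesis .
qed

lemma QM_eq_sum_positive_classes:
  "real (QM r t u) = (\<Sum>P\<in>UNIV. real (card (positive_class r P t u)))"
proof -
  have "lattice_points r t u \<subseteq> (\<Union>P. positive_class r P t u)"
    by (auto simp: positive_class_def)
  then have "finite (lattice_points r t u)"
    by (rule finite_subset) (intro finite_UN_I finite finite_positive_class)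
  then have "card (lattice_points r t u) = (\<Sum>P\<in>UNIV. card (positive_class r P t u))"
    using sum.group[of "lattice_points r t u" UNIV "\<lambda>z. {i. 0 < z i}" "\<lambda>_. 1 :: nat"]
    by (simp add: positive_class_def)
  then show ?thesis
    unfolding QM_eq_card_lattice_points of_nat_sum by simp
qed

lemma hook_sum_QM:
  "hook_sum (\<lambda>s v. real (QM r s v)) t u =
     (\<Sum>P\<in>UNIV. real ((t + (card (- P) - (r UNIV - r P))) choose card (- P)) *
                 real ((u + r P) choose card P))"
  unfolding QM_eq_sum_positive_classes hook_sum_sum[OF finite] hook_sum_positive_class ..

end

section \<open>The Tutte polynomial\<close>

definition hook_coeff :: "('n::finite set \<Rightarrow> nat) \<Rightarrow> nat \<Rightarrow> nat \<Rightarrow> real" where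
  "hook_coeff r = fwd_diff2 (hook_sum (\<lambda>a b. real (QM r a b)))"

lemma QM_coeff_eq_fwd_diff2: "QM_coeff r = fwd_diff2 (\<lambda>a b. real (QM r a b))"
  by (simp add: fun_eq_iff QM_coeff_def fwd_diff2_def)

(* x^(|E|-r(E)) y^r(E) T_M((x+y-1)/y, (x+y-1)/x) in the variables X = x - 1, Y = y - 1
   (tutte_numer_eq_tutte). *)
definition tutte_numer :: "('n::finite set \<Rightarrow> nat) \<Rightarrow> real \<Rightarrow> real \<Rightarrow> real" where
  "tutte_numer r X Y = (\<Sum>P\<in>UNIV. X ^ (r UNIV - r P) * (1 + X) ^ (card (- P) - (r UNIV - r P)) *
                                 (Y ^ (card P - r P) * (1 + Y) ^ r P))"

lemma binomial_expansion_shifted: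
  fixes X :: real
  assumes "c + d = m" and "m \<le> n"
  shows "(\<Sum>i\<le>n. (if i \<le> m then real (d choose (m - i)) else 0) * X ^ i) = X ^ c * (1 + X) ^ d"
proof -
  have "(\<Sum>i\<le>n. (if i \<le> m then real (d choose (m - i)) else 0) * X ^ i)
      = (\<Sum>i\<le>m. real (d choose (m - i)) * X ^ i)"
    using assms(2) by (intro sum.mono_neutral_cong_right) auto
  also have "\<dots> = (\<Sum>l\<le>m. real (d choose l) * X ^ (m - l))"
    by (subst sum.atLeastAtMost_rev[of _ 0 m, simplified atLeast0AtMost]) simp
  also have "\<dots> = (\<Sum>l\<le>d. real (d choose l) * X ^ (m - l))"
    using assms(1) by (intro sum.mono_neutral_cong_right) auto
  also have "\<dots> = (\<Sum>l\<le>d. X ^ c * (real (d choose l) * 1 ^ l * X ^ (d - l)))"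
  proof (intro sum.cong refl)
    fix l assume "l \<in> {..d}"
    then have "m - l = c + (d - l)" using assms(1) by auto
    then show "real (d choose l) * X ^ (m - l) = X ^ c * (real (d choose l) * 1 ^ l * X ^ (d - l))"
      by (simp add: power_add)
  qed
  also have "\<dots> = X ^ c * (1 + X) ^ d"
    by (simp add: binomial_ring[of 1 X d] sum_distrib_left)
  finally show ?thesis .
qed

lemma sum_minus_one_power_card: "(\<Sum>P\<in>(UNIV :: 'n::finite set set). (-1::real) ^ card P) = 0"
proof -
  have "(\<Prod>x\<in>(UNIV :: 'n set). (1::real) - 1) =
      (\<Sum>P\<in>Pow (UNIV :: 'n set). (-1) ^ card P * (\<Prod>x\<in>P. 1) * (\<Prod>x\<in>UNIV - P. 1))"
    by (rule prod_diff_conv_sum) simp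
  moreover have "(\<Prod>x\<in>(UNIV :: 'n set). (1::real) - 1) = 0"
    by (simp add: card_gt_0_iff)
  ultimately show ?thesis by simp
qed

lemma tutte_term_on_line:
  fixes X Y :: real
  assumes "X + Y = -1"
  shows "X ^ c * (1 + X) ^ m * (Y ^ k * (1 + Y) ^ p) = (-1) ^ (m + p) * X ^ (c + p) * Y ^ (m + k)"
proof -
  have "1 + X = - Y" "1 + Y = - X"
    using assms by auto
  then have "(1 + X) ^ m = (-1) ^ m * Y ^ m" "(1 + Y) ^ p = (-1) ^ p * X ^ p"
    by (metis power_minus)+
  then show ?thesis
    by (simp add: power_add mult_ac)
qed

lemma tutte_substitution_term:
  fixes x y :: real
  assumes "x \<noteq> 0" and "y \<noteq> 0"
  shows "x ^ (m + k) * y ^ (p + c) * (((x - 1) / y) ^ c * ((y - 1) / x) ^ k)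
       = (x - 1) ^ c * x ^ m * ((y - 1) ^ k * y ^ p)"
  using assms by (simp add: power_add power_divide field_simps)

context matroid
begin

lemma hook_coeff_eq:
  "hook_coeff r i j =
     (\<Sum>P\<in>UNIV. (if i \<le> card (- P) then real ((card (- P) - (r UNIV - r P)) choose (card (- P) - i)) else 0) *
                (if j \<le> card P then real (r P choose (card P - j)) else 0))"
proof -
  have "hook_sum (\<lambda>a b. real (QM r a b)) = (\<lambda>t u. \<Sum>P\<in>UNIV.
      real ((t + (card (- P) - (r UNIV - r P))) choose card (- P)) * real ((u + r P) choose card P))"
    by (intro ext) (rule hook_sum_QM)
  then show ?thesis
    unfolding hook_coeff_def by (simp add: fwd_diff2_sum fwd_diff2_product fwd_diff_binomial)
qed

lemma hook_coeff_vanishes: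
  assumes "CARD('n) < i + j"
  shows "hook_coeff r i j = 0"
  unfolding hook_coeff_eq
proof (intro sum.neutral ballI)
  fix P :: "'n set"
  have "\<not> (i \<le> card (- P) \<and> j \<le> card P)"
    using assms card_add_card_Compl[of P] by linarith
  then show "(if i \<le> card (- P) then real ((card (- P) - (r UNIV - r P)) choose (card (- P) - i)) else 0) *
      (if j \<le> card P then real (r P choose (card P - j)) else 0) = 0"
    by auto
qed

lemma hook_coeff_poly:
  "(\<Sum>i\<le>CARD('n). \<Sum>j\<le>CARD('n). hook_coeff r i j * X ^ i * Y ^ j) = tutte_numer r X Y"
proof -
  define a where "a P i = (if i \<le> card (- P) then
      real ((card (- P) - (r UNIV - r P)) choose (card (- P) - i)) else 0)" for P i
  define b where "b P j = (if j \<le> card P then real (r P choose (card P - j)) else 0)" for P j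
  have "(\<Sum>i\<le>CARD('n). \<Sum>j\<le>CARD('n). hook_coeff r i j * X ^ i * Y ^ j)
      = (\<Sum>i\<le>CARD('n). \<Sum>j\<le>CARD('n). \<Sum>P\<in>UNIV. (a P i * X ^ i) * (b P j * Y ^ j))"
    unfolding hook_coeff_eq a_def b_def sum_distrib_right by (simp add: mult_ac)
  also have "\<dots> = (\<Sum>i\<le>CARD('n). \<Sum>P\<in>UNIV. \<Sum>j\<le>CARD('n). (a P i * X ^ i) * (b P j * Y ^ j))"
    by (intro sum.cong refl) (rule sum.swap)
  also have "\<dots> = (\<Sum>P\<in>UNIV. (\<Sum>i\<le>CARD('n). a P i * X ^ i) * (\<Sum>j\<le>CARD('n). b P j * Y ^ j))"
    unfolding sum_product by (rule sum.swap)
  also have "\<dots> = tutte_numer r X Y"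
    unfolding tutte_numer_def
  proof (intro sum.cong refl)
    fix P :: "'n set"
    have "r UNIV - r P + (card (- P) - (r UNIV - r P)) = card (- P)"
      "card P - r P + r P = card P" "card P \<le> CARD('n)" "card (- P) \<le> CARD('n)"
      using rank_UNIV_le[of P] rank_le_card[of P] card_add_card_Compl[of P] by auto
    then show "(\<Sum>i\<le>CARD('n). a P i * X ^ i) * (\<Sum>j\<le>CARD('n). b P j * Y ^ j)
        = X ^ (r UNIV - r P) * (1 + X) ^ (card (- P) - (r UNIV - r P)) *
          (Y ^ (card P - r P) * (1 + Y) ^ r P)"
      unfolding a_def b_def by (simp only: binomial_expansion_shifted)
  qed
  finally show ?thesis .
qed

lemma tutte_numer_on_line:
  assumes "X + Y = -1"
  shows "tutte_numer r X Y = 0"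
proof -
  define n where "n = CARD('n)"
  define R where "R = r UNIV"
  have "X ^ (R - r P) * (1 + X) ^ (card (- P) - (R - r P)) * (Y ^ (card P - r P) * (1 + Y) ^ r P)
      = (-1) ^ (n - R) * X ^ R * Y ^ (n - R) * (-1) ^ card P" for P
  proof -
    have bounds: "r P \<le> card P" "r P \<le> R" "R - r P \<le> card (- P)" "card P + card (- P) = n"
      using rank_le_card rank_le_rank_UNIV rank_UNIV_le[of P] card_add_card_Compl[of P]
      by (auto simp: R_def n_def)
    have "(-1::real) ^ (card (- P) - (R - r P) + r P)
        = (-1) ^ (card (- P) - (R - r P) + r P + 2 * card P)"
      by (simp add: power_add power_mult)
    also have "card (- P) - (R - r P) + r P + 2 * card P = (n - R + 2 * r P) + card P"
      using bounds by simp
    finally have sign: "(-1::real) ^ (card (- P) - (R - r P) + r P) = (-1) ^ (n - R) * (-1) ^ card P"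
      by (simp add: power_add power_mult)
    have "R - r P + r P = R" "card (- P) - (R - r P) + (card P - r P) = n - R"
      using bounds by simp_all
    then show ?thesis
      unfolding tutte_term_on_line[OF assms] sign by (simp add: mult_ac)
  qed
  then have "tutte_numer r X Y = (\<Sum>P :: 'n set\<in>UNIV. (-1) ^ (n - R) * X ^ R * Y ^ (n - R) * (-1) ^ card P)"
    by (simp add: tutte_numer_def R_def)
  also have "\<dots> = 0"
    by (simp add: sum_distrib_left[symmetric] sum_minus_one_power_card)
  finally show ?thesis .
qed

lemma QM_coeff_poly_times_trinomial:
  "(\<Sum>i<CARD('n). \<Sum>j<CARD('n). QM_coeff r i j * X ^ i * Y ^ j) * (1 + X + Y) = tutte_numer r X Y"
proof -
  interpret trinomial_multiple_poly "QM_coeff r" "hook_coeff r" "CARD('n)"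
  proof
    show "hook_coeff r i j = QM_coeff r i j + (if i = 0 then 0 else QM_coeff r (i - 1) j)
        + (if j = 0 then 0 else QM_coeff r i (j - 1))" for i j
      unfolding hook_coeff_def QM_coeff_eq_fwd_diff2 by (rule fwd_diff2_hook_sum)
    show "CARD('n) < i + j \<Longrightarrow> hook_coeff r i j = 0" for i j
      by (rule hook_coeff_vanishes)
    show "X + Y = -1 \<Longrightarrow> (\<Sum>i\<le>CARD('n). \<Sum>j\<le>CARD('n). hook_coeff r i j * X ^ i * Y ^ j) = 0" for X Y
      unfolding hook_coeff_poly by (rule tutte_numer_on_line)
  qed
  show ?thesis
    using poly_c_times_trinomial hook_coeff_poly by simp
qed

lemma tutte_numer_eq_tutte:
  fixes x y :: real
  assumes "x \<noteq> 0" and "y \<noteq> 0"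
  shows "x ^ (CARD('n) - r UNIV) * y ^ r UNIV * tutte r ((x + y - 1) / y) ((x + y - 1) / x)
       = tutte_numer r (x - 1) (y - 1)"
  unfolding tutte_def tutte_numer_def sum_distrib_left
proof (intro sum.cong refl)
  fix P :: "'n set"
  have "card (- P) - (r UNIV - r P) + (card P - r P) = CARD('n) - r UNIV" "r P + (r UNIV - r P) = r UNIV"
    using rank_le_card[of P] rank_le_rank_UNIV[of P] rank_UNIV_le[of P] card_add_card_Compl[of P] by auto
  note term_eq = tutte_substitution_term[OF assms, of "card (- P) - (r UNIV - r P)" "card P - r P" "r P"
      "r UNIV - r P", unfolded this]
  have shift: "(x + y - 1) / y - 1 = (x - 1) / y" "(x + y - 1) / x - 1 = (y - 1) / x"
    using assms by (simp_all add: field_simps)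
  show "x ^ (CARD('n) - r UNIV) * y ^ r UNIV *
        (((x + y - 1) / y - 1) ^ (r UNIV - r P) * ((x + y - 1) / x - 1) ^ (card P - r P)) =
      (x - 1) ^ (r UNIV - r P) * (1 + (x - 1)) ^ (card (- P) - (r UNIV - r P)) *
        ((y - 1) ^ (card P - r P) * (1 + (y - 1)) ^ r P)"
    unfolding shift term_eq by simp
qed

end

theorem mainTheorem1:
  fixes r :: "'n::finite set \<Rightarrow> nat" and x y :: real
  assumes "matroid_rank r"
    and "x \<noteq> 0" and "y \<noteq> 0" and "x + y - 1 \<noteq> 0"
  shows "QM' r x y =
    x ^ (CARD('n) - r UNIV) * y ^ (r UNIV) / (x + y - 1) *
      tutte r ((x + y - 1) / y) ((x + y - 1) / x)"
proof -
  interpret matroid r by (rule matroid.intro) fact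
  have "QM' r x y * (x + y - 1) = tutte_numer r (x - 1) (y - 1)"
    using QM_coeff_poly_times_trinomial[of "x - 1" "y - 1"] by (simp add: QM'_def algebra_simps)
  then show ?thesis
    using tutte_numer_eq_tutte[OF assms(2,3)] assms(4) by (simp add: field_simps)
qed

end
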